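(* Let $A$ be an algebra such that the commutator $[\cdot,\cdot]_A$ is commutative and distributive with respect to arbitrary joins, $\nabla_A\in\mathcal{K}(A)$, and $\mathcal{K}(A)$ is closed with respect to the commutator of $A$. Then $\mathcal{L}(A)$ is a bounded sublattice of $\mathrm{Con}(A)/{\equiv_A}$, and thus $\mathcal{L}(A)$ is a bounded distributive lattice.
   Context: $A$ is a (non-empty) universal algebra of some signature $\tau$. $\mathrm{Con}(A)$ is the complete lattice of congruences of $A$, with meet $\cap$, join $\vee$, least element $\Delta_A=\{(x,x)\mid x\in A\}$ and greatest element $\nabla_A=A^2$. $\mathcal{K}(A)$ is the set of finitely generated (equivalently, compact) congruences of $A$. Commutator: for $\alpha,\beta,\mu\in\mathrm{Con}(A)$, $C(\alpha,\beta;\mu)$ means: for all $n,k\in\mathbb{N}$ and every term $t$ of arity $n+k$, if $(a_i,b_i)\in\alpha$ for $1\le i\le n$ and $(c_j,d_j)\in\beta$ for $1\le j\le k$, then $(t^A(\vec a,\vec c),t^A(\vec a,\vec d))\in\mu$ iff $(t^A(\vec b,\vec c),t^A(\vec b,\vec d))\in\mu$. Put $[\alpha,\beta]_A=\bigcap\{\mu\in\mathrm{Con}(A)\mid C(\alpha,\beta;\mu)\}$. One always has $[\alpha,\beta]_A\subseteq\alpha\cap\beta$ and monotonicity in both arguments. "Distributive with respect to arbitrary joins" means $[\bigvee_i\alpha_i,\bigvee_j\beta_j]_A=\bigvee_i\bigvee_j[\alpha_i,\beta_j]_A$ for all families. A congruence $\phi\neq\nabla_A$ is prime iff for all $\alpha,\beta\in\mathrm{Con}(A)$,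 $[\alpha,\beta]_A\subseteq\phi$ implies $\alpha\subseteq\phi$ or $\beta\subseteq\phi$; $\mathrm{Spec}(A)$ is the set of prime congruences. The radical of $\theta$ is $\rho_A(\theta)=\bigcap\{\phi\in\mathrm{Spec}(A)\mid\theta\subseteq\phi\}$ (with empty intersection $\nabla_A$). $\equiv_A$ is the equivalence on $\mathrm{Con}(A)$ given by $\alpha\equiv_A\beta$ iff $\rho_A(\alpha)=\rho_A(\beta)$; $\widehat\alpha$ is the class of $\alpha$. The operations on $\mathrm{Con}(A)/{\equiv_A}$ are (well defined by) $\widehat\alpha\vee\widehat\beta=\widehat{\alpha\vee\beta}$, $\widehat\alpha\wedge\widehat\beta=\widehat{\alpha\cap\beta}=\widehat{[\alpha,\beta]_A}$, $\mathbf{0}=\widehat{\Delta_A}$, $\mathbf{1}=\widehat{\nabla_A}$. $\mathcal{L}(A)=\{\widehat\alpha\mid\alpha\in\mathcal{K}(A)\}\subseteq\mathrm{Con}(A)/{\equiv_A}$. *)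

theory Defs
  imports "HOL-Algebra.Congruence"
begin

section \<open>Universal algebras, terms and congruences\<close>

text \<open>
  The signature is given by a set of operation symbols (possibly empty, possibly with nullary
  symbols) together with the arities; its fields are part of the record.  Operations take their
  arguments as a list; only lists over the carrier whose length is the arity matter.
\<close>

record ('a, 'f) algebra = "'a partial_object" +
  symbols :: "'f set"
  arity :: "'f \<Rightarrow> nat"
  interp :: "'f \<Rightarrow> 'a list \<Rightarrow> 'a"

definition universal_algebra :: "('a, 'f) algebra \<Rightarrow> bool" where
  "universal_algebra A \<longleftrightarrow>
     carrier A \<noteq> {} \<and>
     (\<forall>f\<in>symbols A. \<forall>xs. set xs \<subseteq> carrier A \<and> length xs = arity A f \<longrightarrow> interp A f xs \<in> carrier A)"

datatype 'f uterm = UVar nat | UOp 'f "'f uterm list"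

text \<open>The terms of arity \<open>m\<close> are those whose variables are among \<open>UVar 0, \<dots>, UVar (m - 1)\<close>.\<close>

fun wf_term :: "('a, 'f) algebra \<Rightarrow> nat \<Rightarrow> 'f uterm \<Rightarrow> bool" where
  "wf_term A m (UVar i) \<longleftrightarrow> i < m"
| "wf_term A m (UOp f ts) \<longleftrightarrow>
     f \<in> symbols A \<and> length ts = arity A f \<and> (\<forall>t\<in>set ts. wf_term A m t)"

fun term_op :: "('a, 'f) algebra \<Rightarrow> 'f uterm \<Rightarrow> 'a list \<Rightarrow> 'a" where
  "term_op A (UVar i) xs = xs ! i"
| "term_op A (UOp f ts) xs = interp A f (map (\<lambda>t. term_op A t xs) ts)"

definition Con :: "('a, 'f) algebra \<Rightarrow> 'a rel set" where
  "Con A = {\<theta>. equiv (carrier A) \<theta> \<and>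
     (\<forall>f\<in>symbols A. \<forall>xs ys. length xs = arity A f \<and> list_all2 (\<lambda>x y. (x, y) \<in> \<theta>) xs ys
        \<longrightarrow> (interp A f xs, interp A f ys) \<in> \<theta>)}"

definition Delta :: "('a, 'f) algebra \<Rightarrow> 'a rel" where
  "Delta A = Id_on (carrier A)"

definition Nabla :: "('a, 'f) algebra \<Rightarrow> 'a rel" where
  "Nabla A = carrier A \<times> carrier A"

definition Cg :: "('a, 'f) algebra \<Rightarrow> 'a rel \<Rightarrow> 'a rel" where
  "Cg A X = \<Inter>{\<theta>\<in>Con A. X \<subseteq> \<theta>}"

definition KCon :: "('a, 'f) algebra \<Rightarrow> 'a rel set" where
  "KCon A = {Cg A X | X. finite X \<and> X \<subseteq> Nabla A}"

definition CJoin :: "('a, 'f) algebra \<Rightarrow> 'a rel set \<Rightarrow> 'a rel" where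
  "CJoin A S = Cg A (\<Union>S)"

definition cjoin :: "('a, 'f) algebra \<Rightarrow> 'a rel \<Rightarrow> 'a rel \<Rightarrow> 'a rel" where
  "cjoin A \<alpha> \<beta> = CJoin A {\<alpha>, \<beta>}"

section \<open>The commutator\<close>

definition centralizes :: "('a, 'f) algebra \<Rightarrow> 'a rel \<Rightarrow> 'a rel \<Rightarrow> 'a rel \<Rightarrow> bool" where
  "centralizes A \<alpha> \<beta> \<mu> \<longleftrightarrow>
     (\<forall>n k t a b c d.
        wf_term A (n + k) t \<and> length a = n \<and> length c = k \<and>
        list_all2 (\<lambda>x y. (x, y) \<in> \<alpha>) a b \<and> list_all2 (\<lambda>x y. (x, y) \<in> \<beta>) c d \<longrightarrow>
        ((term_op A t (a @ c), term_op A t (a @ d)) \<in> \<mu> \<longleftrightarrow>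
         (term_op A t (b @ c), term_op A t (b @ d)) \<in> \<mu>))"

definition commutator :: "('a, 'f) algebra \<Rightarrow> 'a rel \<Rightarrow> 'a rel \<Rightarrow> 'a rel" where
  "commutator A \<alpha> \<beta> = \<Inter>{\<mu>\<in>Con A. centralizes A \<alpha> \<beta> \<mu>}"

definition commutator_commutative :: "('a, 'f) algebra \<Rightarrow> bool" where
  "commutator_commutative A \<longleftrightarrow>
     (\<forall>\<alpha>\<in>Con A. \<forall>\<beta>\<in>Con A. commutator A \<alpha> \<beta> = commutator A \<beta> \<alpha>)"

text \<open>
  Joins depend only on the set of members of a family, so families of congruences are represented
  by arbitrary (possibly empty) sets of congruences.
\<close>

definition commutator_distributive :: "('a, 'f) algebra \<Rightarrow> bool" where
  "commutator_distributive A \<longleftrightarrow>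
     (\<forall>S T. S \<subseteq> Con A \<and> T \<subseteq> Con A \<longrightarrow>
        commutator A (CJoin A S) (CJoin A T) =
        CJoin A ((\<lambda>\<alpha>. CJoin A ((\<lambda>\<beta>. commutator A \<alpha> \<beta>) ` T)) ` S))"

section \<open>Prime congruences, radicals and the quotient of the congruence lattice\<close>

definition prime_congruence :: "('a, 'f) algebra \<Rightarrow> 'a rel \<Rightarrow> bool" where
  "prime_congruence A \<phi> \<longleftrightarrow> \<phi> \<in> Con A \<and> \<phi> \<noteq> Nabla A \<and>
     (\<forall>\<alpha>\<in>Con A. \<forall>\<beta>\<in>Con A. commutator A \<alpha> \<beta> \<subseteq> \<phi> \<longrightarrow> \<alpha> \<subseteq> \<phi> \<or> \<beta> \<subseteq> \<phi>)"

definition Spec :: "('a, 'f) algebra \<Rightarrow> 'a rel set" where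
  "Spec A = {\<phi>. prime_congruence A \<phi>}"

text \<open>Intersecting with \<open>Nabla A\<close> only serves to make the empty intersection equal to \<open>Nabla A\<close>.\<close>

definition radical :: "('a, 'f) algebra \<Rightarrow> 'a rel \<Rightarrow> 'a rel" where
  "radical A \<theta> = Nabla A \<inter> \<Inter>{\<phi>\<in>Spec A. \<theta> \<subseteq> \<phi>}"

definition rad_equiv :: "('a, 'f) algebra \<Rightarrow> 'a rel rel" where
  "rad_equiv A = {(\<alpha>, \<beta>) \<in> Con A \<times> Con A. radical A \<alpha> = radical A \<beta>}"

definition hat :: "('a, 'f) algebra \<Rightarrow> 'a rel \<Rightarrow> 'a rel set" where
  "hat A \<alpha> = rad_equiv A `` {\<alpha>}"

definition QCon :: "('a, 'f) algebra \<Rightarrow> 'a rel set set" where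
  "QCon A = Con A // rad_equiv A"

text \<open>
  The operations on classes are defined as the union of the result classes over all choices of
  representatives.  That all choices give the same class is shown below in \<open>hat_join\<close>, \<open>hat_meet\<close>
  and \<open>hat_meet_commutator\<close>.
\<close>

definition hat_join :: "('a, 'f) algebra \<Rightarrow> 'a rel set \<Rightarrow> 'a rel set \<Rightarrow> 'a rel set" where
  "hat_join A X Y = (\<Union>\<alpha>\<in>X. \<Union>\<beta>\<in>Y. hat A (cjoin A \<alpha> \<beta>))"

definition hat_meet :: "('a, 'f) algebra \<Rightarrow> 'a rel set \<Rightarrow> 'a rel set \<Rightarrow> 'a rel set" where
  "hat_meet A X Y = (\<Union>\<alpha>\<in>X. \<Union>\<beta>\<in>Y. hat A (\<alpha> \<inter> \<beta>))"

definition LCon :: "('a, 'f) algebra \<Rightarrow> 'a rel set set" where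
  "LCon A = hat A ` KCon A"

section \<open>Lattices as sets with operations\<close>

definition bounded_lattice_on ::
  "'b set \<Rightarrow> ('b \<Rightarrow> 'b \<Rightarrow> 'b) \<Rightarrow> ('b \<Rightarrow> 'b \<Rightarrow> 'b) \<Rightarrow> 'b \<Rightarrow> 'b \<Rightarrow> bool" where
  "bounded_lattice_on L join meet zero one \<longleftrightarrow>
     zero \<in> L \<and> one \<in> L \<and>
     (\<forall>x\<in>L. \<forall>y\<in>L. join x y \<in> L \<and> meet x y \<in> L) \<and>
     (\<forall>x\<in>L. \<forall>y\<in>L. join x y = join y x \<and> meet x y = meet y x) \<and>
     (\<forall>x\<in>L. \<forall>y\<in>L. \<forall>z\<in>L. join (join x y) z = join x (join y z) \<and>
                         meet (meet x y) z = meet x (meet y z)) \<and>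
     (\<forall>x\<in>L. \<forall>y\<in>L. join x (meet x y) = x \<and> meet x (join x y) = x) \<and>
     (\<forall>x\<in>L. join zero x = x \<and> meet one x = x)"

definition bounded_distributive_lattice_on ::
  "'b set \<Rightarrow> ('b \<Rightarrow> 'b \<Rightarrow> 'b) \<Rightarrow> ('b \<Rightarrow> 'b \<Rightarrow> 'b) \<Rightarrow> 'b \<Rightarrow> 'b \<Rightarrow> bool" where
  "bounded_distributive_lattice_on L join meet zero one \<longleftrightarrow>
     bounded_lattice_on L join meet zero one \<and>
     (\<forall>x\<in>L. \<forall>y\<in>L. \<forall>z\<in>L. meet x (join y z) = join (meet x y) (meet x z))"

definition bounded_sublattice_of ::
  "'b set \<Rightarrow> 'b set \<Rightarrow> ('b \<Rightarrow> 'b \<Rightarrow> 'b) \<Rightarrow> ('b \<Rightarrow> 'b \<Rightarrow> 'b) \<Rightarrow> 'b \<Rightarrow> 'b \<Rightarrow> bool" where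
  "bounded_sublattice_of M L join meet zero one \<longleftrightarrow>
     bounded_lattice_on L join meet zero one \<and>
     M \<subseteq> L \<and> zero \<in> M \<and> one \<in> M \<and>
     (\<forall>x\<in>M. \<forall>y\<in>M. join x y \<in> M \<and> meet x y \<in> M)"

section \<open>Well-definedness of the operations on classes\<close>

lemma Nabla_Con:
  assumes "universal_algebra A"
  shows "Nabla A \<in> Con A"
proof -
  have *: "set xs \<subseteq> carrier A \<and> set ys \<subseteq> carrier A \<and> length xs = length ys"
    if "list_all2 (\<lambda>x y. (x, y) \<in> carrier A \<times> carrier A) xs ys" for xs ys
    using that by (induction rule: list_all2_induct) auto
  have "equiv (carrier A) (carrier A \<times> carrier A)"
    by (auto intro!: equivI refl_onI symI transI)
  with * assms show ?thesis
    by (fastforce simp: Con_def Nabla_def universal_algebra_def)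
qed

lemma Con_equiv: "\<theta> \<in> Con A \<Longrightarrow> equiv (carrier A) \<theta>"
  by (simp add: Con_def)

lemma Con_refl: "\<theta> \<in> Con A \<Longrightarrow> x \<in> carrier A \<Longrightarrow> (x, x) \<in> \<theta>"
  by (auto simp: Con_def equiv_def refl_on_def)

lemma Con_sym: "\<theta> \<in> Con A \<Longrightarrow> (x, y) \<in> \<theta> \<Longrightarrow> (y, x) \<in> \<theta>"
  by (auto simp: Con_def equiv_def elim: symE)

lemma Con_trans: "\<theta> \<in> Con A \<Longrightarrow> (x, y) \<in> \<theta> \<Longrightarrow> (y, z) \<in> \<theta> \<Longrightarrow> (x, z) \<in> \<theta>"
  by (auto simp: Con_def equiv_def elim: transE)

lemma Con_sub: "\<theta> \<in> Con A \<Longrightarrow> \<theta> \<subseteq> Nabla A"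
  by (auto simp: Con_def equiv_def Nabla_def)

lemma Con_op:
  "\<lbrakk>\<theta> \<in> Con A; f \<in> symbols A; length xs = arity A f; list_all2 (\<lambda>x y. (x, y) \<in> \<theta>) xs ys\<rbrakk>
     \<Longrightarrow> (interp A f xs, interp A f ys) \<in> \<theta>"
  by (auto simp: Con_def)

lemma Con_Inter:
  assumes "S \<subseteq> Con A" "S \<noteq> {}"
  shows "\<Inter>S \<in> Con A"
proof -
  have "equiv (carrier A) (\<Inter>S)"
  proof (rule equivI)
    obtain \<theta> where "\<theta> \<in> S" "\<theta> \<in> Con A" using assms by auto
    then show "\<Inter>S \<subseteq> carrier A \<times> carrier A"
      using Con_sub[of \<theta> A] by (auto simp: Nabla_def)
    show "refl_on (carrier A) (\<Inter>S)"
      using assms(1) by (auto intro!: refl_onI intro: Con_refl)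
    show "sym (\<Inter>S)"
    proof (intro symI InterI)
      fix x y \<theta> assume "(x, y) \<in> \<Inter>S" "\<theta> \<in> S"
      then show "(y, x) \<in> \<theta>" using assms(1) Con_sym[of \<theta> A x y] by auto
    qed
    show "trans (\<Inter>S)"
    proof (intro transI InterI)
      fix x y z \<theta> assume "(x, y) \<in> \<Inter>S" "(y, z) \<in> \<Inter>S" "\<theta> \<in> S"
      then show "(x, z) \<in> \<theta>" using assms(1) Con_trans[of \<theta> A x y z] by auto
    qed
  qed
  moreover have "(interp A f xs, interp A f ys) \<in> \<Inter>S"
    if "f \<in> symbols A" "length xs = arity A f" "list_all2 (\<lambda>x y. (x, y) \<in> \<Inter>S) xs ys" for f xs ys
  proof
    fix \<theta> assume "\<theta> \<in> S"
    then have "list_all2 (\<lambda>x y. (x, y) \<in> \<theta>) xs ys"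
      using that(3) by (auto elim: list_all2_mono)
    with \<open>\<theta> \<in> S\<close> assms that show "(interp A f xs, interp A f ys) \<in> \<theta>"
      using Con_op[of \<theta> A f xs ys] by auto
  qed
  ultimately show ?thesis by (auto simp: Con_def)
qed

lemma Con_Int: "\<alpha> \<in> Con A \<Longrightarrow> \<beta> \<in> Con A \<Longrightarrow> \<alpha> \<inter> \<beta> \<in> Con A"
  using Con_Inter[of "{\<alpha>, \<beta>}" A] by simp

lemma Cg_Con:
  assumes "universal_algebra A" "X \<subseteq> Nabla A"
  shows "Cg A X \<in> Con A"
  unfolding Cg_def using assms Nabla_Con by (intro Con_Inter) auto

lemma cjoin_Con:
  "universal_algebra A \<Longrightarrow> \<alpha> \<in> Con A \<Longrightarrow> \<beta> \<in> Con A \<Longrightarrow> cjoin A \<alpha> \<beta> \<in> Con A"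
  unfolding cjoin_def CJoin_def using Con_sub by (intro Cg_Con) auto

lemma cjoin_le_iff:
  "\<phi> \<in> Con A \<Longrightarrow> cjoin A \<alpha> \<beta> \<subseteq> \<phi> \<longleftrightarrow> \<alpha> \<subseteq> \<phi> \<and> \<beta> \<subseteq> \<phi>"
  unfolding cjoin_def CJoin_def Cg_def by blast

lemma term_op_Con:
  assumes "\<theta> \<in> Con A" "list_all2 (\<lambda>x y. (x, y) \<in> \<theta>) xs ys" "wf_term A (length xs) t"
  shows "(term_op A t xs, term_op A t ys) \<in> \<theta>"
  using assms(3)
proof (induction t)
  case (UVar i)
  then show ?case using assms(2) by (auto simp: list_all2_conv_all_nth)
next
  case (UOp f ts)
  then show ?case
    by (auto intro!: Con_op[OF assms(1)] simp: list_all2_conv_all_nth)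
qed

lemma list_all2_Con_refl:
  "\<theta> \<in> Con A \<Longrightarrow> set xs \<subseteq> carrier A \<Longrightarrow> list_all2 (\<lambda>x y. (x, y) \<in> \<theta>) xs xs"
  by (auto intro!: list.rel_refl_strong Con_refl)

lemma list_all2_Con_carrier:
  assumes "\<theta> \<in> Con A" "list_all2 (\<lambda>x y. (x, y) \<in> \<theta>) xs ys"
  shows "set xs \<subseteq> carrier A \<and> set ys \<subseteq> carrier A"
  using assms(2) Con_sub[OF assms(1)]
  by (induction rule: list_all2_induct) (auto simp: Nabla_def)

lemma centralizes_left:
  assumes "\<alpha> \<in> Con A" "\<beta> \<in> Con A"
  shows "centralizes A \<alpha> \<beta> \<alpha>"
  unfolding centralizes_def
proof (intro allI impI, elim conjE)
  fix n k t a b c d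
  assume t: "wf_term A (n + k) t" "length a = n" "length c = k"
    and ab: "list_all2 (\<lambda>x y. (x, y) \<in> \<alpha>) a b" and cd: "list_all2 (\<lambda>x y. (x, y) \<in> \<beta>) c d"
  have "(term_op A t (a @ e), term_op A t (b @ e)) \<in> \<alpha>"
    if "e \<in> {c, d}" for e
    using that t list_all2_Con_carrier[OF assms(2) cd] list_all2_lengthD[OF cd]
    by (intro term_op_Con[OF assms(1)] list_all2_appendI ab list_all2_Con_refl[OF assms(1)]) auto
  then show "(term_op A t (a @ c), term_op A t (a @ d)) \<in> \<alpha> \<longleftrightarrow>
             (term_op A t (b @ c), term_op A t (b @ d)) \<in> \<alpha>"
    using Con_sym[OF assms(1)] Con_trans[OF assms(1)] by (meson insertCI)
qed

lemma centralizes_right: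
  assumes "\<alpha> \<in> Con A" "\<beta> \<in> Con A"
  shows "centralizes A \<alpha> \<beta> \<beta>"
  unfolding centralizes_def
proof (intro allI impI, elim conjE)
  fix n k t a b c d
  assume t: "wf_term A (n + k) t" "length a = n" "length c = k"
    and ab: "list_all2 (\<lambda>x y. (x, y) \<in> \<alpha>) a b" and cd: "list_all2 (\<lambda>x y. (x, y) \<in> \<beta>) c d"
  have "(term_op A t (e @ c), term_op A t (e @ d)) \<in> \<beta>"
    if "e \<in> {a, b}" for e
    using that t list_all2_Con_carrier[OF assms(1) ab] list_all2_lengthD[OF ab]
    by (intro term_op_Con[OF assms(2)] list_all2_appendI cd list_all2_Con_refl[OF assms(2)]) auto
  then show "(term_op A t (a @ c), term_op A t (a @ d)) \<in> \<beta> \<longleftrightarrow>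
             (term_op A t (b @ c), term_op A t (b @ d)) \<in> \<beta>"
    by blast
qed

lemma commutator_le_Int:
  "\<alpha> \<in> Con A \<Longrightarrow> \<beta> \<in> Con A \<Longrightarrow> commutator A \<alpha> \<beta> \<subseteq> \<alpha> \<inter> \<beta>"
  unfolding commutator_def using centralizes_left centralizes_right by blast

lemma commutator_Con:
  "\<alpha> \<in> Con A \<Longrightarrow> \<beta> \<in> Con A \<Longrightarrow> commutator A \<alpha> \<beta> \<in> Con A"
  unfolding commutator_def using centralizes_left by (intro Con_Inter) auto

lemma radical_eq_iff:
  assumes "\<alpha> \<in> Con A" "\<beta> \<in> Con A"
  shows "radical A \<alpha> = radical A \<beta> \<longleftrightarrow> (\<forall>\<phi>\<in>Spec A. \<alpha> \<subseteq> \<phi> \<longleftrightarrow> \<beta> \<subseteq> \<phi>)"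
proof -
  have *: "\<theta> \<subseteq> \<phi> \<longleftrightarrow> radical A \<theta> \<subseteq> \<phi>" if "\<theta> \<in> Con A" "\<phi> \<in> Spec A" for \<theta> \<phi>
    using that Con_sub[of \<theta> A] unfolding radical_def by blast
  show ?thesis
  proof
    show "radical A \<alpha> = radical A \<beta> \<Longrightarrow> \<forall>\<phi>\<in>Spec A. \<alpha> \<subseteq> \<phi> \<longleftrightarrow> \<beta> \<subseteq> \<phi>"
      using * assms by metis
  next
    assume "\<forall>\<phi>\<in>Spec A. \<alpha> \<subseteq> \<phi> \<longleftrightarrow> \<beta> \<subseteq> \<phi>"
    then have "{\<phi>\<in>Spec A. \<alpha> \<subseteq> \<phi>} = {\<phi>\<in>Spec A. \<beta> \<subseteq> \<phi>}" by blast
    then show "radical A \<alpha> = radical A \<beta>" unfolding radical_def by simp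
  qed
qed

lemma equiv_rad_equiv: "equiv (Con A) (rad_equiv A)"
  by (auto simp: rad_equiv_def intro!: equivI refl_onI symI transI)

lemma hat_eq_iff:
  "\<alpha> \<in> Con A \<Longrightarrow> \<beta> \<in> Con A \<Longrightarrow>
     hat A \<alpha> = hat A \<beta> \<longleftrightarrow> (\<forall>\<phi>\<in>Spec A. \<alpha> \<subseteq> \<phi> \<longleftrightarrow> \<beta> \<subseteq> \<phi>)"
  unfolding hat_def eq_equiv_class_iff[OF equiv_rad_equiv] 
  by (simp add: rad_equiv_def radical_eq_iff)

lemma mem_hat_iff:
  "\<alpha> \<in> Con A \<Longrightarrow>
     \<beta> \<in> hat A \<alpha> \<longleftrightarrow> \<beta> \<in> Con A \<and> (\<forall>\<phi>\<in>Spec A. \<alpha> \<subseteq> \<phi> \<longleftrightarrow> \<beta> \<subseteq> \<phi>)"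
  using radical_eq_iff[of \<alpha> A \<beta>] by (auto simp only: hat_def rad_equiv_def)

lemma Spec_commutator_iff:
  assumes "\<phi> \<in> Spec A" "\<alpha> \<in> Con A" "\<beta> \<in> Con A"
  shows "commutator A \<alpha> \<beta> \<subseteq> \<phi> \<longleftrightarrow> \<alpha> \<subseteq> \<phi> \<or> \<beta> \<subseteq> \<phi>"
  using assms commutator_le_Int[OF assms(2,3)] unfolding Spec_def prime_congruence_def by blast

lemma Spec_Int_iff:
  assumes "\<phi> \<in> Spec A" "\<alpha> \<in> Con A" "\<beta> \<in> Con A"
  shows "\<alpha> \<inter> \<beta> \<subseteq> \<phi> \<longleftrightarrow> \<alpha> \<subseteq> \<phi> \<or> \<beta> \<subseteq> \<phi>"
  using Spec_commutator_iff[OF assms] commutator_le_Int[OF assms(2,3)] by blast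

lemma Spec_Con: "\<phi> \<in> Spec A \<Longrightarrow> \<phi> \<in> Con A"
  by (simp add: Spec_def prime_congruence_def)

lemma hat_join:
  assumes "universal_algebra A" "\<alpha> \<in> Con A" "\<beta> \<in> Con A"
  shows "hat_join A (hat A \<alpha>) (hat A \<beta>) = hat A (cjoin A \<alpha> \<beta>)"
proof -
  have "hat A (cjoin A \<alpha>' \<beta>') = hat A (cjoin A \<alpha> \<beta>)"
    if "\<alpha>' \<in> hat A \<alpha>" "\<beta>' \<in> hat A \<beta>" for \<alpha>' \<beta>'
    using that assms by (auto simp: mem_hat_iff hat_eq_iff cjoin_Con cjoin_le_iff Spec_Con)
  moreover have "\<alpha> \<in> hat A \<alpha>" "\<beta> \<in> hat A \<beta>"
    using assms by (auto simp: mem_hat_iff)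
  ultimately show ?thesis unfolding hat_join_def by blast
qed

lemma hat_meet:
  assumes "\<alpha> \<in> Con A" "\<beta> \<in> Con A"
  shows "hat_meet A (hat A \<alpha>) (hat A \<beta>) = hat A (\<alpha> \<inter> \<beta>)"
proof -
  have "hat A (\<alpha>' \<inter> \<beta>') = hat A (\<alpha> \<inter> \<beta>)"
    if "\<alpha>' \<in> hat A \<alpha>" "\<beta>' \<in> hat A \<beta>" for \<alpha>' \<beta>'
    using that assms by (auto simp: mem_hat_iff hat_eq_iff Con_Int Spec_Int_iff)
  moreover have "\<alpha> \<in> hat A \<alpha>" "\<beta> \<in> hat A \<beta>"
    using assms by (auto simp: mem_hat_iff)
  ultimately show ?thesis unfolding hat_meet_def by blast
qed

lemma hat_meet_commutator:
  assumes "\<alpha> \<in> Con A" "\<beta> \<in> Con A"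
  shows "hat_meet A (hat A \<alpha>) (hat A \<beta>) = hat A (commutator A \<alpha> \<beta>)"
  using assms
  by (simp add: hat_meet hat_eq_iff Con_Int commutator_Con Spec_Int_iff Spec_commutator_iff)

end

(* A class in the quotient of Con(A) is determined by the set of primes above a representative.
   Joins become intersections and meets become unions of such sets, so the quotient is a bounded
   distributive lattice.  An intersection of compact congruences need not be compact, but its class
   is also the class of the commutator, which is compact by hypothesis. *)

theory Submission
  imports Defs
begin

lemma Delta_Con: "universal_algebra A \<Longrightarrow> Delta A \<in> Con A"
proof -
  assume A: "universal_algebra A"
  \<comment> \<open>Lists related entrywise by the diagonal coincide, so compatibility with an
    operation reduces to the operation staying inside the carrier.\<close>
  have eq: "xs = ys \<and> set xs \<subseteq> carrier A"
    if "list_all2 (\<lambda>x y. (x, y) \<in> Id_on (carrier A)) xs ys" for xs ys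
    using that by (induction rule: list_all2_induct) auto
  have "equiv (carrier A) (Id_on (carrier A))"
    by (auto intro!: equivI refl_onI symI transI)
  with eq A show ?thesis
    by (fastforce simp: Con_def Delta_def universal_algebra_def)
qed

lemma Delta_le: "\<theta> \<in> Con A \<Longrightarrow> Delta A \<subseteq> \<theta>"
  by (auto simp: Delta_def intro: Con_refl)

text \<open>Primes are proper; this is what makes the class of \<open>Nabla A\<close> neutral for
  meets.\<close>

lemma Spec_not_Nabla_le: "\<phi> \<in> Spec A \<Longrightarrow> \<not> Nabla A \<subseteq> \<phi>"
  using Con_sub[of \<phi> A] by (auto simp: Spec_def prime_congruence_def)

text \<open>\<open>Delta A\<close> is itself a congruence and lies below all others. This exhibits
  it as finitely generated, by no pairs at all.\<close>

lemma Cg_empty: "universal_algebra A \<Longrightarrow> Cg A {} = Delta A"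
  using Delta_Con[of A] Delta_le[of _ A] unfolding Cg_def by blast

lemma Cg_le_iff: "\<phi> \<in> Con A \<Longrightarrow> Cg A X \<subseteq> \<phi> \<longleftrightarrow> X \<subseteq> \<phi>"
  unfolding Cg_def by blast

text \<open>A congruence contains \<open>Cg A X\<close> exactly when it contains \<open>X\<close>,
  so both sides intersect the same family. For finite \<open>X\<close> and \<open>Y\<close> this
  keeps joins compact.\<close>

lemma cjoin_Cg: "cjoin A (Cg A X) (Cg A Y) = Cg A (X \<union> Y)"
proof -
  have "{\<theta> \<in> Con A. \<Union>{Cg A X, Cg A Y} \<subseteq> \<theta>} = {\<theta> \<in> Con A. X \<union> Y \<subseteq> \<theta>}"
    by (intro Collect_cong conj_cong) (simp_all add: Cg_le_iff)
  \<comment> \<open>The instances of \<open>Cg_def\<close> unfold only the two outer closures;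
    \<open>Cg A X\<close> and \<open>Cg A Y\<close> stay folded to match the equation above.\<close>
  then show ?thesis unfolding cjoin_def CJoin_def Cg_def[of A "\<Union>_"] Cg_def[of A "X \<union> Y"] by simp
qed

lemma KCon_Con: "universal_algebra A \<Longrightarrow> \<alpha> \<in> KCon A \<Longrightarrow> \<alpha> \<in> Con A"
  by (auto simp: KCon_def Cg_Con)

lemma Delta_KCon: "universal_algebra A \<Longrightarrow> Delta A \<in> KCon A"
  unfolding KCon_def by (auto simp flip: Cg_empty)

lemma cjoin_KCon: "\<alpha> \<in> KCon A \<Longrightarrow> \<beta> \<in> KCon A \<Longrightarrow> cjoin A \<alpha> \<beta> \<in> KCon A"
  unfolding KCon_def by clarsimp (metis cjoin_Cg finite_UnI Un_least)

lemma QCon_image: "QCon A = hat A ` Con A"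
  by (auto simp: QCon_def quotient_def hat_def)

lemma LCon_subset_QCon: "universal_algebra A \<Longrightarrow> LCon A \<subseteq> QCon A"
  using KCon_Con[of A] by (auto simp: LCon_def QCon_image)

lemma QCon_bounded_distributive_lattice:
  assumes A: "universal_algebra A"
  shows "bounded_distributive_lattice_on (QCon A)
           (hat_join A) (hat_meet A) (hat A (Delta A)) (hat A (Nabla A))"
proof -
  note Cons = Delta_Con[OF A] Nabla_Con[OF A] cjoin_Con[OF A] Con_Int
  note ops = hat_join[OF A] hat_meet
  note primes = hat_eq_iff cjoin_le_iff Spec_Con Spec_Int_iff Delta_le Spec_not_Nabla_le
  \<comment> \<open>\<open>QCon_image\<close> and \<open>ball_simps(9)\<close> turn quantifiers over
    classes into quantifiers over congruences. Each law is then, prime by prime, a propositional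
    tautology in statements such as \<open>\<alpha> \<subseteq> \<phi>\<close>.\<close>
  show ?thesis
    unfolding bounded_distributive_lattice_on_def bounded_lattice_on_def QCon_image
      ball_simps(9)
    by (intro conjI ballI imageI Cons) (auto simp: Cons ops primes)
qed

text \<open>The laws are universally quantified identities and restrict to subsets; closure and the
  bounds come from the sublattice.\<close>

lemma bounded_sublattice_distributive:
  assumes "bounded_sublattice_of M L join meet zero one"
    and "bounded_distributive_lattice_on L join meet zero one"
  shows "bounded_distributive_lattice_on M join meet zero one"
  using assms
  unfolding bounded_sublattice_of_def bounded_distributive_lattice_on_def bounded_lattice_on_def
  by (simp add: subset_iff)

theorem proposition5p13:
  fixes A :: "('a, 'f) algebra"
  assumes "universal_algebra A"
    and "commutator_commutative A"
    and "commutator_distributive A"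
    and "Nabla A \<in> KCon A"
    and "\<forall>\<alpha>\<in>KCon A. \<forall>\<beta>\<in>KCon A. commutator A \<alpha> \<beta> \<in> KCon A"
  shows "bounded_sublattice_of (LCon A) (QCon A)
           (hat_join A) (hat_meet A) (hat A (Delta A)) (hat A (Nabla A)) \<and>
         bounded_distributive_lattice_on (LCon A)
           (hat_join A) (hat_meet A) (hat A (Delta A)) (hat A (Nabla A))"
proof -
  note A = assms(1)
  note QCon = QCon_bounded_distributive_lattice[OF A]
  have "hat_join A x y \<in> LCon A" if "x \<in> LCon A" "y \<in> LCon A" for x y
    using that by (auto simp: LCon_def hat_join[OF A] KCon_Con[OF A] cjoin_KCon)
  \<comment> \<open>Rewriting with \<open>hat_meet_commutator\<close> instead of
    \<open>hat_meet\<close> yields a compact representative.\<close>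
  moreover have "hat_meet A x y \<in> LCon A" if "x \<in> LCon A" "y \<in> LCon A" for x y
    using that assms(5) by (auto simp: LCon_def hat_meet_commutator KCon_Con[OF A])
  moreover have "hat A (Delta A) \<in> LCon A" "hat A (Nabla A) \<in> LCon A"
    using Delta_KCon[OF A] assms(4) by (auto simp: LCon_def)
  ultimately have "bounded_sublattice_of (LCon A) (QCon A)
           (hat_join A) (hat_meet A) (hat A (Delta A)) (hat A (Nabla A))"
    using QCon LCon_subset_QCon[OF A]
    by (simp add: bounded_sublattice_of_def bounded_distributive_lattice_on_def)
  then show ?thesis
    using bounded_sublattice_distributive[OF _ QCon] by simp
qed

end
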